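(* Let $p$ be a prime and let $f(n)=g_1(n)g_2(n)\cdots g_r(n)$, where $g_i(n)\in\mathbb{Z}[n]$ for all $1\le i\le r$. Consider a node on the $p$-adic valuation tree of $\{\nu_p(f(n))\}_{n\ge 0}$. If, for every $1\le i\le r$, that node, or a node at a higher level that contains it, is terminating on the $p$-adic valuation tree of $\{\nu_p(g_i(n))\}_{n\ge 0}$, then the node is terminating on the tree of $\{\nu_p(f(n))\}_{n\ge 0}$. Moreover, the valuation of this node is the sum over $1\le i\le r$ of the valuations of the individual factors $g_i$ at that node.
   Context: For a prime $p$, $\nu_p$ is the usual $p$-adic valuation on $\mathbb{Q}$, with $\nu_p(0)=+\infty$. Valuation tree. Given a sequence of rational numbers $\{S_n\}_{n\ge 0}$, the $p$-adic valuation tree of $\{\nu_p(S_n)\}_{n\ge 0}$ is built as follows. The $0$-th level, which is the highest level, has a single node, containing all terms of the sequence. A node at level $k$ consists of the terms $S_m$ whose index $m$ has the form $m=c_0+c_1p+\cdots+c_{k-1}p^{k-1}+np^k$, $n\ge 0$, for fixed digits $0\le c_i\le p-1$; nodes of trees of different sequences are identified when they have the same set of indices, and a node contains another if its set of indices does. A node is terminating if $\nu_p(S_m)$ has the same value for all terms $S_m$ in the node (this common value is "the valuation" of the node); it is non-terminating if at least two terms in the node have different valuations. A terminating node does not split. A non-terminating node at level $k$ splits into the $p$ nodes at level $k+1$ whose indices are $m=c_0+\cdots+c_{k-1}p^{k-1}+c_kp^k+np^{k+1}$, $n\ge 0$, one for each $0\le c_k\le p-1$. "Higher level" means a level closer to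 the $0$-th level, i.e. with smaller number. If a node is contained in a terminating node on the tree of $\{\nu_p(g_i(n))\}_{n\ge 0}$, the valuation of $g_i$ at the node is the valuation of that terminating node. *)

theory Defs
  imports
    "HOL-Computational_Algebra.Computational_Algebra"
    "HOL-Library.Extended"
begin

text \<open>The value \<^term>\<open>Minf\<close> of \<^typ>\<open>int extended\<close> is never attained.\<close>

definition padic_val :: "nat \<Rightarrow> rat \<Rightarrow> int extended" where
  "padic_val p x =
     (if x = 0 then Pinf
      else Fin (int (multiplicity (int p) (fst (quotient_of x)))
              - int (multiplicity (int p) (snd (quotient_of x)))))"

text \<open>A node is represented by its set of indices.  A list of digits \<open>cs\<close> of length \<open>k\<close> stands
  for the indices congruent to \<open>c\<^sub>0 + c\<^sub>1 p + \<dots> + c\<^bsub>k-1\<^esub> p\<^bsup>k-1\<^esup>\<close> modulo \<open>p\<^bsup>k\<^esup>\<close>.\<close>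

definition node_indices :: "nat \<Rightarrow> nat list \<Rightarrow> nat set" where
  "node_indices p cs =
     {m. \<exists>n. m = (\<Sum>i<length cs. cs ! i * p ^ i) + n * p ^ length cs}"

definition terminating :: "nat \<Rightarrow> (nat \<Rightarrow> rat) \<Rightarrow> nat set \<Rightarrow> bool" where
  "terminating p S N \<longleftrightarrow> (\<forall>m\<in>N. \<forall>m'\<in>N. padic_val p (S m) = padic_val p (S m'))"

inductive tree_digits :: "nat \<Rightarrow> (nat \<Rightarrow> rat) \<Rightarrow> nat list \<Rightarrow> bool"
  for p :: nat and S :: "nat \<Rightarrow> rat" where
  root: "tree_digits p S []"
| split: "tree_digits p S cs \<Longrightarrow> \<not> terminating p S (node_indices p cs) \<Longrightarrow> c < p
            \<Longrightarrow> tree_digits p S (cs @ [c])"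

definition tree_node :: "nat \<Rightarrow> (nat \<Rightarrow> rat) \<Rightarrow> nat \<Rightarrow> nat set \<Rightarrow> bool" where
  "tree_node p S k N \<longleftrightarrow>
     (\<exists>cs. tree_digits p S cs \<and> length cs = k \<and> N = node_indices p cs)"

definition terminating_node :: "nat \<Rightarrow> (nat \<Rightarrow> rat) \<Rightarrow> nat \<Rightarrow> nat set \<Rightarrow> bool" where
  "terminating_node p S k N \<longleftrightarrow> tree_node p S k N \<and> terminating p S N"

definition node_valuation :: "nat \<Rightarrow> (nat \<Rightarrow> rat) \<Rightarrow> nat set \<Rightarrow> int extended" where
  "node_valuation p S N = (THE v. \<forall>m\<in>N. padic_val p (S m) = v)"

text \<open>Here \<open>N\<close> need not be a node of the tree of \<open>S\<close>; it only has to be contained in a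
  terminating node \<open>M\<close> of that tree, whose valuation it receives.\<close>

definition valuation_at :: "nat \<Rightarrow> (nat \<Rightarrow> rat) \<Rightarrow> nat set \<Rightarrow> int extended" where
  "valuation_at p S N =
     (THE v. \<exists>j M. terminating_node p S j M \<and> N \<subseteq> M \<and> v = node_valuation p S M)"

definition poly_seq :: "int poly \<Rightarrow> nat \<Rightarrow> rat" where
  "poly_seq g n = of_int (poly g (int n))"

end

theory Submission
  imports Defs
begin

text \<open>The valuation \<open>\<nu>\<^sub>p\<close> turns products of integers into sums, including the case of a zero factor,
  since \<open>+\<infinity>\<close> absorbs every value that occurs (lemma \<open>padic_val_prod\<close>).  Each factor
  \<open>g\<^sub>i\<close> has constant valuation on the given node, because the node lies inside a terminating
  node of the tree of \<open>g\<^sub>i\<close>; so the sum of these valuations is constant on the node as well.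
  Nodes are nonempty, so the constant value of \<open>g\<^sub>i\<close> on the given node determines the
  valuation of every terminating node above it (lemma \<open>valuation_at_eq\<close>).\<close>

lemma padic_val_of_int:
  "padic_val p (of_int a) = (if a = 0 then Pinf else Fin (int (multiplicity (int p) a)))"
  by (simp add: padic_val_def)

lemma padic_val_mult:
  assumes "prime p"
  shows "padic_val p (of_int (a * b)) = padic_val p (of_int a) + padic_val p (of_int b)"
proof -
  have "prime_elem (int p)"
    using assms by (intro prime_imp_prime_elem) simp
  then have "multiplicity (int p) (a * b) = multiplicity (int p) a + multiplicity (int p) b"
    if "a \<noteq> 0" "b \<noteq> 0"
    using that by (rule prime_elem_multiplicity_mult_distrib)
  then show ?thesis
    unfolding padic_val_of_int by simp
qed

lemma padic_val_prod:
  assumes "prime p"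
  shows "padic_val p (of_int (\<Prod>i\<in>I. a i)) = (\<Sum>i\<in>I. padic_val p (of_int (a i)))"
proof -
  have one: "padic_val p 1 = 0"
    using padic_val_of_int[of p 1] by (simp add: zero_extended_def)
  show ?thesis
  proof (induction I rule: infinite_finite_induct)
    case (insert i I)
    then show ?case
      using padic_val_mult[OF assms, of "a i" "\<Prod>i\<in>I. a i"] by simp
  qed (simp_all add: one)
qed

lemma node_indices_nonempty: "node_indices p cs \<noteq> {}"
  unfolding node_indices_def by blast

lemma node_valuation_eq:
  assumes "terminating p S N" and "m \<in> N"
  shows "node_valuation p S N = padic_val p (S m)"
  unfolding node_valuation_def
  using assms unfolding terminating_def by (intro the_equality) metis+

text \<open>The valuation inherited from a terminating node does not depend on which terminating
  node above \<open>N\<close> is chosen: all of them share the index \<open>m\<close>.\<close>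

lemma valuation_at_eq:
  assumes M: "terminating_node p S j M" "N \<subseteq> M" and m: "m \<in> N"
  shows "valuation_at p S N = padic_val p (S m)"
proof -
  have eq: "node_valuation p S M' = padic_val p (S m)"
    if "terminating_node p S j' M'" "N \<subseteq> M'" for j' M'
    using that m by (intro node_valuation_eq) (auto simp: terminating_node_def)
  show ?thesis
    unfolding valuation_at_def
  proof (rule the_equality)
    show "\<exists>j M. terminating_node p S j M \<and> N \<subseteq> M \<and> padic_val p (S m) = node_valuation p S M"
      using M eq[OF M] by metis
  qed (use eq in auto)
qed

theorem proposition6p2:
  fixes p r k :: nat and f :: "int poly" and g :: "nat \<Rightarrow> int poly" and N :: "nat set"
  assumes "prime p"
    and "f = (\<Prod>i = 1..r. g i)"
    and "tree_node p (poly_seq f) k N"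
    and "\<forall>i\<in>{1..r}. terminating_node p (poly_seq (g i)) k N \<or>
           (\<exists>j<k. \<exists>M. terminating_node p (poly_seq (g i)) j M \<and> N \<subseteq> M)"
  shows "terminating_node p (poly_seq f) k N \<and>
         node_valuation p (poly_seq f) N = (\<Sum>i = 1..r. valuation_at p (poly_seq (g i)) N)"
proof -
  have val: "padic_val p (poly_seq f m) = (\<Sum>i = 1..r. valuation_at p (poly_seq (g i)) N)"
    if "m \<in> N" for m
  proof -
    have "padic_val p (poly_seq f m) = (\<Sum>i = 1..r. padic_val p (poly_seq (g i) m))"
      unfolding poly_seq_def assms(2) poly_prod by (rule padic_val_prod[OF assms(1)])
    also have "\<dots> = (\<Sum>i = 1..r. valuation_at p (poly_seq (g i)) N)"
    proof (rule sum.cong)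
      fix i assume "i \<in> {1..r}"
      with assms(4) obtain j M where "terminating_node p (poly_seq (g i)) j M" "N \<subseteq> M"
        by blast
      then show "padic_val p (poly_seq (g i) m) = valuation_at p (poly_seq (g i)) N"
        using that by (simp add: valuation_at_eq)
    qed simp
    finally show ?thesis .
  qed
  then have const: "terminating p (poly_seq f) N"
    by (simp add: terminating_def)
  obtain m where "m \<in> N"
    using assms(3) node_indices_nonempty by (auto simp: tree_node_def)
  then have "node_valuation p (poly_seq f) N = (\<Sum>i = 1..r. valuation_at p (poly_seq (g i)) N)"
    using node_valuation_eq[OF const] val by simp
  with const assms(3) show ?thesis
    by (simp add: terminating_node_def)
qed

end
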